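(* Let $k\geq 2$ and let \[ y_{k}=\frac{1-(k-2)x-\sqrt{(1-kx)^{2}-4x^{2}}}{2x(1-(k-2)x)}, \] where the square root is the formal power series in $x$ with constant term $1$ (so that $y_k$ is a formal power series in $x$). For integers $0\le i<j$ put $\beta_{i,j}=jx\prod_{s=i+1}^{j-1}(sx-1)$ (an empty product equals $1$), and put $\beta_{j,j}=1$. Then the ordinary generating function for the number of $(k,2)$-noncrossing partitions of $[n]$ is \[ \sum_{n\geq 0}\#\mathcal{P}_{k}(n)x^{n}=\frac{\frac{x^{k-1}y_{k}}{1-xy_{k}}+\sum_{j=0}^{k-2}\sum_{i=0}^{j}(-1)^{i+j}x^{i}\beta _{i,j}}{1-\sum_{j=0}^{k-2}\sum_{i=0}^{j}(-1)^{i+j}ix\beta _{i,j}}, \] where $\mathcal{P}_k(n)$ denotes the set of $(k,2)$-noncrossing partitions of $[n]=\{1,\dots,n\}$.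
   Context: A set partition of $[n]$ is identified with its canonical sequential form $\pi_1\pi_2\cdots\pi_n$: list the blocks $B_1,\dots,B_d$ in increasing order of their minimum elements and set $\pi_i=m$ iff $i\in B_m$ (the empty word is the unique partition of $[0]$). The reduced form of a word over letters $a_1<\dots<a_d$ is obtained by renaming $a_i$ as $i$. A partition $\pi$ avoids a word $\tau$ if no subsequence $\pi_{i_1}\cdots\pi_{i_m}$ ($i_1<\dots<i_m$) has the same reduced form as $\tau$. A partition is $(k,d)$-noncrossing if it avoids $12\cdots k12\cdots d$; in particular $(k,2)$-noncrossing means avoiding $12\cdots k12$. *)

theory Defs
  imports
    Complex_Main
    "HOL-Library.Disjoint_Sets"
    "HOL-Library.Sublist"
    "HOL-Computational_Algebra.Formal_Power_Series"
begin

definition block_list :: "nat set set \<Rightarrow> nat set list" where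
  "block_list P = sorted_key_list_of_set Min P"

(* Lists are indexed from 0, so the block B_m is block_list P ! (m - 1), and the letter pi_i is
   canonical_form n P ! (i - 1). *)
definition canonical_form :: "nat \<Rightarrow> nat set set \<Rightarrow> nat list" where
  "canonical_form n P =
     map (\<lambda>i. THE m. 1 \<le> m \<and> m \<le> length (block_list P) \<and> i \<in> block_list P ! (m - 1)) [1..<n + 1]"

(* The i-th smallest letter of w is the letter a for which i letters of w are at most a. *)
definition reduced_form :: "nat list \<Rightarrow> nat list" where
  "reduced_form w = map (\<lambda>a. card {b \<in> set w. b \<le> a}) w"

definition avoids :: "nat list \<Rightarrow> nat list \<Rightarrow> bool" where
  "avoids w \<tau> \<longleftrightarrow> \<not> (\<exists>u. subseq u w \<and> reduced_form u = reduced_form \<tau>)"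

definition crossing_word :: "nat \<Rightarrow> nat \<Rightarrow> nat list" where
  "crossing_word k d = [1..<k + 1] @ [1..<d + 1]"

definition noncrossing :: "nat \<Rightarrow> nat \<Rightarrow> nat \<Rightarrow> nat set set \<Rightarrow> bool" where
  "noncrossing k d n P \<longleftrightarrow> avoids (canonical_form n P) (crossing_word k d)"

definition noncrossing_partitions :: "nat \<Rightarrow> nat \<Rightarrow> nat set set set" where
  "noncrossing_partitions k n = {P. partition_on {1..n} P \<and> noncrossing k 2 n P}"

(* fps_radical root 2 f is the square root of f whose constant term is the real square root of
   that of f; see fps_sqrt_series below. *)
definition sqrt_series :: "nat \<Rightarrow> real fps" where
  "sqrt_series k = fps_radical root 2 ((1 - of_nat k * fps_X)^2 - 4 * fps_X^2)"

(* Division of power series cancels the common factor fps_X; see y_series_mult below. *)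
definition y_series :: "nat \<Rightarrow> real fps" where
  "y_series k =
     (1 - of_nat (k - 2) * fps_X - sqrt_series k) / (2 * fps_X * (1 - of_nat (k - 2) * fps_X))"

definition beta_series :: "nat \<Rightarrow> nat \<Rightarrow> real fps" where
  "beta_series i j =
     (if i = j then 1 else of_nat j * fps_X * (\<Prod>s\<in>{i<..<j}. of_nat s * fps_X - 1))"

lemma fps_sqrt_series:
  "fps_nth (sqrt_series k) 0 = 1"
  "sqrt_series k ^ 2 = (1 - of_nat k * fps_X)^2 - 4 * fps_X^2"
proof -
  let ?a = "(1 - of_nat k * fps_X)^2 - 4 * fps_X^2 :: real fps"
  have a0: "fps_nth ?a 0 = 1"
    by (simp add: power2_eq_square)
  show "fps_nth (sqrt_series k) 0 = 1"
    using a0 by (simp add: sqrt_series_def)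
  have "root (Suc 1) (fps_nth ?a 0) ^ Suc 1 = fps_nth ?a 0"
    unfolding a0 by simp
  then show "sqrt_series k ^ 2 = ?a"
    using power_radical[of ?a root 1] a0 by (simp add: sqrt_series_def numeral_2_eq_2)
qed

lemma y_series_mult:
  "y_series k * (2 * fps_X * (1 - of_nat (k - 2) * fps_X)) =
     1 - of_nat (k - 2) * fps_X - sqrt_series k"
proof -
  let ?g = "2 * fps_X * (1 - of_nat (k - 2) * fps_X) :: real fps"
  let ?f = "1 - of_nat (k - 2) * fps_X - sqrt_series k"
  have u: "is_unit (2 * (1 - of_nat (k - 2) * fps_X) :: real fps)"
    by (simp add: fps_is_unit_iff)
  have "fps_nth ?f 0 = 0"
    by (simp add: fps_sqrt_series)
  then have "?f = fps_X * fps_shift 1 ?f"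
    by (intro fps_ext) (simp del: fps_sub_nth)
  then have "fps_X dvd ?f"
    by (rule dvdI)
  moreover have "?g dvd fps_X"
  proof -
    have "?g = fps_X * (2 * (1 - of_nat (k - 2) * fps_X))"
      by (simp only: mult_ac)
    then show ?thesis
      using mult_unit_dvd_iff[OF u, of fps_X fps_X] by simp
  qed
  ultimately have "?g dvd ?f"
    using dvd_trans by blast
  then show ?thesis
    unfolding y_series_def by (rule dvd_div_mult_self)
qed

lemma block_list_properties:
  assumes P: "partition_on {1..n} P"
  shows "set (block_list P) = P" "distinct (block_list P)"
    "sorted_wrt (<) (map Min (block_list P))"
proof -
  have fin: "finite P"
    using P finite_elements[of "{1..n}" P] by simp
  have ne: "B \<noteq> {}" "finite B" if "B \<in> P" for B
    using P that finite_subset[of B "{1..n}"] by (auto simp: partition_on_def)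
  have inj: "inj_on Min P"
  proof (rule inj_onI)
    fix A B assume "A \<in> P" "B \<in> P" "Min A = Min B"
    then show "A = B"
      using disjointD[OF partition_onD2[OF P], of A B] Min_in[OF ne(2) ne(1), of A]
        Min_in[OF ne(2) ne(1), of B] by auto
  qed
  have eq: "linorder.sorted_key_list_of_set (\<le>) (Min :: nat set \<Rightarrow> nat) = sorted_key_list_of_set Min"
    by (simp add: fun_eq_iff linorder.sorted_key_list_of_set_def[OF linorder_axioms]
        linorder.insort_key_def[OF linorder_axioms] linorder_class.insort_key_def
        sorted_key_list_of_set_def)
  interpret folding_insort_key "(\<le>)" "(<)" P "Min :: nat set \<Rightarrow> nat"
    rewrites "linorder.sorted_key_list_of_set (\<le>) (Min :: nat set \<Rightarrow> nat) = sorted_key_list_of_set Min"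
    by unfold_locales (rule inj, rule eq)
  show "set (block_list P) = P" "distinct (block_list P)"
    using fin set_sorted_key_list_of_set[of P] distinct_sorted_key_list_of_set[of P]
    by (simp_all add: block_list_def distinct_map)
  show "sorted_wrt (<) (map Min (block_list P))"
    unfolding block_list_def by (rule strict_sorted_key_list_of_set) simp
qed

lemma canonical_form_unique:
  assumes P: "partition_on {1..n} P" and i: "i \<in> {1..n}"
    and m: "1 \<le> m" "m \<le> length (block_list P)"
  shows "canonical_form n P ! (i - 1) = m \<longleftrightarrow> i \<in> block_list P ! (m - 1)"
proof -
  have s: "set (block_list P) = P" and d: "distinct (block_list P)"
    using block_list_properties[OF P] by simp_all
  have uniq: "a = b" if "1 \<le> a" "a \<le> length (block_list P)" "i \<in> block_list P ! (a - 1)"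
      "1 \<le> b" "b \<le> length (block_list P)" "i \<in> block_list P ! (b - 1)" for a b
  proof -
    have "block_list P ! (a - 1) \<in> P" "block_list P ! (b - 1) \<in> P"
      using that s nth_mem[of "a - 1" "block_list P"] nth_mem[of "b - 1" "block_list P"] by auto
    then have "block_list P ! (a - 1) = block_list P ! (b - 1)"
      using that disjointD[OF partition_onD2[OF P]] by blast
    then have "a - 1 = b - 1"
      using that d by (subst (asm) nth_eq_iff_index_eq) auto
    then show ?thesis
      using that by linarith
  qed
  obtain B where "B \<in> P" "i \<in> B"
    using i partition_onD1[OF P] by blast
  then obtain t where t: "t < length (block_list P)" "i \<in> block_list P ! t"
    using s by (metis in_set_conv_nth)
  let ?Q = "\<lambda>a. 1 \<le> a \<and> a \<le> length (block_list P) \<and> i \<in> block_list P ! (a - 1)"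
  have Q: "?Q (Suc t)"
    using t by simp
  have c: "canonical_form n P ! (i - 1) = (THE a. ?Q a)"
    unfolding canonical_form_def using i by (subst nth_map) (auto simp del: upt_Suc)
  have "(THE a. ?Q a) = Suc t"
    using Q uniq by (intro the_equality) blast+
  with c have c': "canonical_form n P ! (i - 1) = Suc t"
    by simp
  show ?thesis
    unfolding c' using Q uniq[of "Suc t" m] m by auto
qed

end

(* Read a canonical form from left to right. The letter b becomes forbidden once some a < b has
   occurred after the letter b + k - 2, because the first occurrences
   of a, b, b + 1, ..., b + k - 2 followed by a b then form the crossing word. Let r be
   the number of letters that have occurred and are not forbidden. The next letter may be new
   (r becomes r + 1), one of the largest k - 2 letters (r is unchanged), or the j-th smallest
   letter otherwise (r becomes k - 2 + j), so avoiding words are counted by walks on r.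
   Put A = 1 - (k - 2) x, so that y = y_k satisfies A y (1 - x y) = 1. The walks that start from
   r = k - 2 + m have generating function y (A y)^m, and the finitely many states r < k - 2 are
   eliminated through (1 - r x) F_r = 1 + x F_(r+1). *)

theory Submission
  imports Defs
begin

section \<open>Restricted growth words\<close>

text \<open>Restricted growth words: first occurrences come in the order 1, 2, 3, .... Stating this
  through prefixes suits words built by appending letters.\<close>

definition rgf :: "nat list \<Rightarrow> bool" where
  "rgf w \<longleftrightarrow> (\<forall>i<length w. 0 < w ! i \<and> {1..<w ! i} \<subseteq> set (take i w))"

lemma rgf_Nil [simp]: "rgf []"
  by (simp add: rgf_def)

lemma rgf_snoc: "rgf (w @ [a]) \<longleftrightarrow> rgf w \<and> 0 < a \<and> {1..<a} \<subseteq> set w"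
  unfolding rgf_def by (auto simp: nth_append less_Suc_eq all_conj_distrib)

lemma rgf_append: "rgf (u @ v) \<Longrightarrow> rgf u"
  by (induction v rule: rev_induct) (auto simp: rgf_snoc simp flip: append_assoc)

text \<open>An appended letter exceeds the current maximum by at most one, so the letters always
  form an initial segment. Inserting 0 covers the empty word.\<close>

lemma rgf_set: "rgf w \<Longrightarrow> set w = {1..Max (insert 0 (set w))}"
proof (induction w rule: rev_induct)
  case Nil
  then show ?case by simp
next
  case (snoc a w)
  define M where "M = Max (insert 0 (set w))"
  have w: "set w = {1..M}" and a: "0 < a" "{1..<a} \<subseteq> set w"
    using snoc by (auto simp: rgf_snoc M_def)
  have "a \<le> Suc M"
  proof (rule ccontr)
    assume "\<not> a \<le> Suc M"
    then have "Suc M \<in> {1..<a}" by auto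
    then have "Suc M \<in> set w" using a by blast
    then show False using w by simp
  qed
  have "insert 0 (set (w @ [a])) = {0..max M a}"
    using w a \<open>a \<le> Suc M\<close> by (auto simp: max_def)
  then have "Max (insert 0 (set (w @ [a]))) = max M a"
    by (simp only:) (rule Max_eqI; auto)
  moreover have "set (w @ [a]) = {1..max M a}"
    using w a \<open>a \<le> Suc M\<close> by (auto simp: max_def)
  ultimately show ?case by (simp only:)
qed

lemma rgf_setE:
  assumes "rgf w"
  obtains M where "set w = {1..M}"
  using rgf_set[OF assms] by blast

text \<open>First occurrences come in increasing order, so they already spell out the
  interval.\<close>

lemma subseq_upt_rgf: "rgf w \<Longrightarrow> set w = {1..M} \<Longrightarrow> subseq [1..<Suc M] w"
proof (induction w arbitrary: M rule: rev_induct)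
  case Nil
  then show ?case by simp
next
  case (snoc a w)
  then have w: "rgf w" "0 < a" "{1..<a} \<subseteq> set w"
    by (auto simp: rgf_snoc)
  then obtain M' where M': "set w = {1..M'}"
    using rgf_setE by blast
  have IH: "subseq [1..<Suc M'] w"
    using snoc.IH[OF w(1) M'] .
  show ?case
  proof (cases "a \<in> set w")
    case True
    then have "{1..M} = {1..M'}"
      using snoc.prems(2) M' True by (simp add: insert_absorb)
    then have "card {1..M} = card {1..M'}" by (rule arg_cong)
    then have "M = M'" by simp
    then show ?thesis using subseq_rev_drop_many[OF IH] by simp
  next
    case False
    have "a = Suc M'"
    proof -
      have "\<not> a > Suc M'"
      proof
        assume "a > Suc M'"
        then have "Suc M' \<in> {1..<a}" by auto
        then have "Suc M' \<in> set w" using w by blast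
        then show False using M' by simp
      qed
      moreover have "\<not> a \<le> M'"
        using False M' w(2) by auto
      ultimately show ?thesis by linarith
    qed
    then have "insert (Suc M') {1..M'} = {1..M}"
      using snoc.prems(2) M' by simp
    then have "card (insert (Suc M') {1..M'}) = card {1..M}" by (rule arg_cong)
    then have "M = Suc M'" by simp
    then have "[1..<Suc M] = [1..<Suc M'] @ [a]"
      using \<open>a = Suc M'\<close> by simp
    then show ?thesis using IH \<open>a = Suc M'\<close> by (simp del: upt_Suc)
  qed
qed

lemma upt_split: "i \<le> j \<Longrightarrow> j \<le> k \<Longrightarrow> [i..<k] = [i..<j] @ [j..<k]"
  using upt_add_eq_append[of i j "k - j"] by simp

lemma subseq_upt_upt:
  assumes "a < b" "a < c"
  shows "subseq (a # [b..<c]) [a..<c]"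
proof (cases "b \<le> c")
  case True
  have "[a..<c] = a # [Suc a..<b] @ [b..<c]"
    using assms True upt_split[of "Suc a" b c] by (simp add: upt_conv_Cons)
  then show ?thesis by (simp add: list_emb_append2)
next
  case False
  then show ?thesis using assms by (simp add: upt_conv_Cons)
qed

section \<open>Containing the crossing word\<close>

lemma card_le_less_iff:
  fixes A :: "nat set"
  assumes "finite A" "a \<in> A" "b \<in> A"
  shows "card {c \<in> A. c \<le> a} < card {c \<in> A. c \<le> b} \<longleftrightarrow> a < b"
proof
  assume "a < b"
  then have "{c \<in> A. c \<le> a} \<subseteq> {c \<in> A. c \<le> b}" "b \<in> {c \<in> A. c \<le> b} - {c \<in> A. c \<le> a}"
    using assms by auto
  then have "{c \<in> A. c \<le> a} \<subset> {c \<in> A. c \<le> b}" by blast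
  then show "card {c \<in> A. c \<le> a} < card {c \<in> A. c \<le> b}"
    using assms by (intro psubset_card_mono) auto
next
  assume "card {c \<in> A. c \<le> a} < card {c \<in> A. c \<le> b}"
  moreover have "card {c \<in> A. c \<le> b} \<le> card {c \<in> A. c \<le> a}" if "b \<le> a"
    using assms that by (intro card_mono) auto
  ultimately show "a < b" by force
qed

lemma length_reduced_form [simp]: "length (reduced_form w) = length w"
  by (simp add: reduced_form_def)

text \<open>Reduced forms record ranks, so words with equal reduced forms have the same order
  comparisons between positions.\<close>

lemma reduced_form_less_iff:
  assumes "i < length w" "j < length w"
  shows "reduced_form w ! i < reduced_form w ! j \<longleftrightarrow> w ! i < w ! j"
  using assms by (simp add: reduced_form_def card_le_less_iff)

text \<open>An increasing renaming preserves ranks; this matches a concrete occurrence with the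
  crossing word.\<close>

lemma reduced_form_map:
  assumes "strict_mono_on (set w) g"
  shows "reduced_form (map g w) = reduced_form w"
proof -
  have "card {b \<in> g ` set w. b \<le> g a} = card {b \<in> set w. b \<le> a}" if "a \<in> set w" for a
  proof -
    have "{b \<in> g ` set w. b \<le> g a} = g ` {b \<in> set w. b \<le> a}"
      using assms that by (auto simp: strict_mono_on_less_eq)
    moreover have "inj_on g {b \<in> set w. b \<le> a}"
      using strict_mono_on_imp_inj_on[OF assms] by (rule inj_on_subset) auto
    ultimately show ?thesis by (simp add: card_image)
  qed
  then show ?thesis by (simp add: reduced_form_def)
qed

text \<open>Appending \<open>b\<close> to \<open>w\<close> completes the pattern \<open>a b (b+1) \<dots> (b+k-2) a b\<close>; in a restricted growth
  word the first half is supplied by first occurrences as soon as \<open>b+k-2\<close> has occurred.\<close>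

definition blocked :: "nat \<Rightarrow> nat list \<Rightarrow> nat \<Rightarrow> bool" where
  "blocked k w b \<longleftrightarrow> (\<exists>p<length w. w ! p < b \<and> b + k - 2 \<in> set (take p w))"

lemma blocked_snoc: "blocked k (w @ [a]) b \<longleftrightarrow> blocked k w b \<or> a < b \<and> b + k - 2 \<in> set w"
proof -
  have split: "(\<exists>p<Suc n. Q p) \<longleftrightarrow> (\<exists>p<n. Q p) \<or> Q n" for Q and n :: nat
    using less_Suc_eq by auto
  show ?thesis
    unfolding blocked_def by (simp add: split nth_append cong: conj_cong)
qed

lemma blocked_append: "blocked k u b \<Longrightarrow> blocked k (u @ v) b"
  by (induction v rule: rev_induct) (auto simp: blocked_snoc simp flip: append_assoc)

lemma blocked_mem: "blocked k w b \<Longrightarrow> b + k - 2 \<in> set w"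
  unfolding blocked_def by (auto dest: in_set_takeD)

section \<open>Avoidance as a condition on each appended letter\<close>

definition nonblocking :: "nat \<Rightarrow> nat list \<Rightarrow> bool" where
  "nonblocking k w \<longleftrightarrow> (\<forall>q<length w. \<not> blocked k (take q w) (w ! q))"

lemma nonblocking_Nil [simp]: "nonblocking k []"
  by (simp add: nonblocking_def)

lemma nonblocking_snoc: "nonblocking k (w @ [a]) \<longleftrightarrow> nonblocking k w \<and> \<not> blocked k w a"
  unfolding nonblocking_def by (auto simp: nth_append less_Suc_eq all_conj_distrib)

lemma strict_sorted_nth_ge:
  fixes f :: "nat \<Rightarrow> nat"
  assumes "\<And>i j. i < j \<Longrightarrow> j < n \<Longrightarrow> f i < f j" "i + m < n"
  shows "f i + m \<le> f (i + m)"
  using assms(2)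
proof (induction m)
  case (Suc m)
  have "f (i + m) < f (i + Suc m)"
    using Suc.prems by (intro assms(1)) auto
  then show ?case using Suc by auto
qed auto

lemma nth_crossing_word:
  assumes "i < k + 2"
  shows "crossing_word k 2 ! i = (if i < k then Suc i else Suc (i - k))"
proof -
  have "[1..<2 + 1] = [1, 2 :: nat]" by (simp add: upt_rec)
  then have "crossing_word k 2 = [Suc 0..<Suc k] @ [1, 2]"
    by (simp add: crossing_word_def)
  moreover have "i - k = 0 \<or> i - k = 1"
    using assms by linarith
  ultimately show ?thesis
    by (auto simp: nth_append simp del: upt_Suc)
qed

lemma length_crossing_word [simp]: "length (crossing_word k 2) = k + 2"
  by (simp add: crossing_word_def)

text \<open>An occurrence has the form \<open>a, b, ..., c, a, b\<close> with \<open>k - 1\<close>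
  increasing letters from \<open>b\<close> to \<open>c\<close>, hence \<open>c\<close> is at least
  \<open>b + k - 2\<close>. The prefix containing \<open>c\<close> is a restricted growth word, so
  it contains \<open>b + k - 2\<close> as well; the second \<open>a\<close> then blocks
  \<open>b\<close>, and the final \<open>b\<close> is a blocked letter.\<close>

lemma not_avoids_imp_blocked:
  assumes "k \<ge> 2" "rgf w" "\<not> avoids w (crossing_word k 2)"
  shows "\<not> nonblocking k w"
proof -
  obtain u where u: "subseq u w" and red: "reduced_form u = reduced_form (crossing_word k 2)"
    using assms(3) by (auto simp: avoids_def)
  have len: "length u = k + 2"
    using arg_cong[OF red, of length] by simp
  have less: "u ! i < u ! j \<longleftrightarrow> crossing_word k 2 ! i < crossing_word k 2 ! j"
    if "i < k + 2" "j < k + 2" for i j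
    using reduced_form_less_iff[of i u j] reduced_form_less_iff[of i "crossing_word k 2" j] red len that
    by simp
  define a b where "a = u ! 0" and "b = u ! 1"
  define v where "v = take k u"
  \<comment> \<open>Neither letter is smaller than the other, because positions 0 and
    \<open>k\<close> of the crossing word both hold 1.\<close>
  have ua: "u ! k = a"
    using less[of 0 k] less[of k 0] assms(1) by (simp add: nth_crossing_word a_def)
  have ub: "u ! (k + 1) = b"
    using less[of 1 "k + 1"] less[of "k + 1" 1] assms(1) by (simp add: nth_crossing_word b_def)
  have "u ! i < u ! j" if "i < j" "j < k" for i j
    using less[of i j] that by (simp add: nth_crossing_word)
  then have incr: "u ! i + m \<le> u ! (i + m)" if "i + m < k" for i m
    using strict_sorted_nth_ge[of k "\<lambda>i. u ! i" i m] that by simp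
  have "drop k u = [a, b]"
    using ua ub len by (intro nth_equalityI) (auto simp: less_Suc_eq numeral_2_eq_2)
  then have "u = v @ [a, b]"
    using append_take_drop_id[of k u] v_def by simp
  then obtain w1 w2 where w: "w = w1 @ w2" "subseq v w1" "subseq [a, b] w2"
    using u list_emb_appendD[of "(=)" v "[a, b]" w] by auto
  from w(3) obtain w3 w4 where w34: "w2 = w3 @ a # w4" "subseq [b] w4"
    using list_emb_ConsD[of "(=)" a "[b]" w2] by auto
  from w34(2) obtain w5 w6 where w56: "w4 = w5 @ b # w6"
    using list_emb_ConsD[of "(=)" b "[]" w4] by auto
  have "u ! (k - 1) \<in> set v"
    using assms(1) len by (auto simp: v_def in_set_conv_nth intro!: exI[of _ "k - 1"])
  then have top: "u ! (k - 1) \<in> set w1"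
    using list_emb_set[OF w(2)] by metis
  \<comment> \<open>From position 1 to position \<open>k - 1\<close> the letters increase
    \<open>k - 2\<close> times.\<close>
  moreover have "b + k - 2 \<le> u ! (k - 1)"
  proof -
    have "1 + (k - 2) = k - 1" using assms(1) by simp
    then show ?thesis using incr[of 1 "k - 2"] assms(1) by (simp add: b_def)
  qed
  moreover have "a < b" 
    using incr[of 0 1] assms(1) by (simp add: a_def b_def)
  moreover have "rgf w1"
    using rgf_append[of w1 w2] assms(2) w(1) by simp
  then obtain M where "set w1 = {1..M}"
    by (rule rgf_setE)
  ultimately have mem: "b + k - 2 \<in> set w1"
    using assms(1) by auto
  then have "blocked k ((w1 @ w3) @ [a]) b"
    using \<open>a < b\<close> by (simp only: blocked_snoc) simp
  then have "blocked k ((w1 @ w3) @ [a] @ w5) b"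
    using blocked_append[of k "(w1 @ w3) @ [a]" b w5] by simp
  moreover have "w = ((w1 @ w3) @ [a] @ w5) @ b # w6"
    using w(1) w34(1) w56 by simp
  ultimately show ?thesis
    unfolding nonblocking_def
    by (auto intro!: exI[of _ "length ((w1 @ w3) @ [a] @ w5)"] simp: nth_append)
qed

text \<open>Before the blocking position \<open>p\<close>, the first occurrences include
  \<open>a, b, ..., b + k - 2\<close> in this order; the letters at \<open>p\<close> and
  \<open>q\<close> supply the final \<open>a, b\<close>.\<close>

lemma blocked_imp_not_avoids:
  assumes "k \<ge> 2" "rgf w" "\<not> nonblocking k w"
  shows "\<not> avoids w (crossing_word k 2)"
proof -
  obtain q p where q: "q < length w" and p: "p < q" "w ! p < w ! q"
    and mem: "w ! q + k - 2 \<in> set (take p w)"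
    using assms(3) by (auto simp: nonblocking_def blocked_def)
  define a b where "a = w ! p" and "b = w ! q"
  have "a < b" "0 < a"
    using p q assms(2) by (auto simp: a_def b_def rgf_def)
  define v where "v = a # [b..<b + k - 1]"
  have "rgf (take p w)"
    using rgf_append[of "take p w" "drop p w"] assms(2) by simp
  then obtain M where M: "set (take p w) = {1..M}"
    by (rule rgf_setE)
  have sub: "subseq [1..<Suc M] (take p w)"
    using subseq_upt_rgf[OF \<open>rgf (take p w)\<close> M] .
  have le: "b + k - 1 \<le> Suc M"
    using mem M by (auto simp: b_def)
  have "[1..<Suc M] = [1..<a] @ [a..<b + k - 1] @ [b + k - 1..<Suc M]"
    using le \<open>a < b\<close> \<open>0 < a\<close> assms(1) upt_split[of 1 a "Suc M"] upt_split[of a "b + k - 1" "Suc M"]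
    by simp
  moreover have "subseq v [a..<b + k - 1]"
    unfolding v_def using \<open>a < b\<close> assms(1) by (intro subseq_upt_upt) auto
  ultimately have "subseq v [1..<Suc M]"
    by (simp only:) (intro subseq_drop_many subseq_rev_drop_many)
  then have v: "subseq v (take p w)"
    using sub by (rule subseq_order.trans)
  have "w = take p w @ [w ! p] @ drop (Suc p) (take q w) @ [w ! q] @ drop (Suc q) w"
  proof -
    define t r where "t = take q w" and "r = [w ! q] @ drop (Suc q) w"
    have r: "t @ r = w"
      using id_take_nth_drop[OF q] by (simp add: t_def r_def)
    have t: "take p w @ [w ! p] @ drop (Suc p) t = t"
      using id_take_nth_drop[of p t] p q by (simp add: t_def min_def)
    have "w = (take p w @ [w ! p] @ drop (Suc p) t) @ r"
      unfolding t by (rule r[symmetric])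
    then show ?thesis by (simp add: t_def r_def)
  qed
  moreover have "subseq (v @ [a] @ [] @ [b] @ [])
      (take p w @ [w ! p] @ drop (Suc p) (take q w) @ [w ! q] @ drop (Suc q) w)"
    using v unfolding a_def b_def by (intro list_emb_append_mono) auto
  ultimately have subseq: "subseq (v @ [a, b]) w"
    by simp
  \<comment> \<open>The order-preserving renaming of the crossing word: 1 becomes \<open>a\<close>,
    and \<open>2, ..., k\<close> become \<open>b, ..., b + k - 2\<close>.\<close>
  define g where "g i = (if i = 1 then a else b + i - 2)" for i :: nat
  have "v @ [a, b] = map g (crossing_word k 2)"
  proof (rule nth_equalityI)
    show "length (v @ [a, b]) = length (map g (crossing_word k 2))"
      using assms(1) by (simp add: v_def)
    fix i assume "i < length (v @ [a, b])"
    then have i: "i < k + 2" using assms(1) by (simp add: v_def)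
    have len: "length v = k" using assms(1) by (simp add: v_def)
    consider "i = 0" | "0 < i" "i < k" | "i = k" | "i = k + 1"
      using i by linarith
    then show "(v @ [a, b]) ! i = map g (crossing_word k 2) ! i"
      using i assms(1) len by cases (auto simp: nth_append nth_crossing_word g_def v_def nth_Cons')
  qed
  moreover have "strict_mono_on (set (crossing_word k 2)) g"
    using \<open>a < b\<close> by (intro strict_mono_onI) (auto simp: g_def crossing_word_def)
  ultimately have "reduced_form (v @ [a, b]) = reduced_form (crossing_word k 2)"
    by (simp add: reduced_form_map)
  then show ?thesis using subseq by (auto simp: avoids_def)
qed

lemma avoids_iff_nonblocking:
  "k \<ge> 2 \<Longrightarrow> rgf w \<Longrightarrow> avoids w (crossing_word k 2) \<longleftrightarrow> nonblocking k w"
  using not_avoids_imp_blocked blocked_imp_not_avoids by blast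

section \<open>Set partitions as restricted growth words\<close>

lemma length_canonical_form [simp]: "length (canonical_form n P) = n"
  by (simp add: canonical_form_def)

text \<open>The inverse of \<open>canonical_form\<close> on restricted growth words. Only letters
  that occur are used, so no block is empty.\<close>

definition blocks_of :: "nat \<Rightarrow> nat list \<Rightarrow> nat set set" where
  "blocks_of n w = (\<lambda>m. {i \<in> {1..n}. w ! (i - 1) = m}) ` set w"

lemma block_list_nth:
  assumes P: "partition_on {1..n} P" and m: "m \<in> {1..length (block_list P)}"
  shows "block_list P ! (m - 1) = {i \<in> {1..n}. canonical_form n P ! (i - 1) = m}"
    and "block_list P ! (m - 1) \<noteq> {}"
proof -
  have len: "m - 1 < length (block_list P)" "1 \<le> m" "m \<le> length (block_list P)"
    using m by auto
  have mem: "block_list P ! (m - 1) \<in> P"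
    using nth_mem[OF len(1)] unfolding block_list_properties(1)[OF P] .
  show "block_list P ! (m - 1) = {i \<in> {1..n}. canonical_form n P ! (i - 1) = m}"
  proof (intro equalityI subsetI)
    fix i assume i: "i \<in> block_list P ! (m - 1)"
    then have "i \<in> {1..n}"
      using partition_onD1[OF P] mem by blast
    then show "i \<in> {i \<in> {1..n}. canonical_form n P ! (i - 1) = m}"
      using canonical_form_unique[OF P _ len(2,3)] i by blast
  next
    fix i assume "i \<in> {i \<in> {1..n}. canonical_form n P ! (i - 1) = m}"
    then show "i \<in> block_list P ! (m - 1)"
      using canonical_form_unique[OF P _ len(2,3)] by blast
  qed
  show "block_list P ! (m - 1) \<noteq> {}"
  proof
    assume "block_list P ! (m - 1) = {}"
    then show False
      using mem partition_onD3[OF P] by simp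
  qed
qed

lemma canonical_form_nth_mem:
  assumes P: "partition_on {1..n} P" and i: "i \<in> {1..n}"
  shows "canonical_form n P ! (i - 1) \<in> {1..length (block_list P)}"
    and "i \<in> block_list P ! (canonical_form n P ! (i - 1) - 1)"
proof -
  obtain B where "B \<in> P" "i \<in> B"
    using i partition_onD1[OF P] by blast
  then obtain t where t: "t < length (block_list P)" "i \<in> block_list P ! t"
    using block_list_properties(1)[OF P] by (metis in_set_conv_nth)
  then have "canonical_form n P ! (i - 1) = Suc t"
    using canonical_form_unique[OF P i, of "Suc t"] by simp
  then show "canonical_form n P ! (i - 1) \<in> {1..length (block_list P)}"
    "i \<in> block_list P ! (canonical_form n P ! (i - 1) - 1)"
    using t by auto
qed

lemma set_canonical_form:
  assumes P: "partition_on {1..n} P"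
  shows "set (canonical_form n P) = {1..length (block_list P)}"
proof (intro equalityI subsetI)
  fix m assume "m \<in> set (canonical_form n P)"
  then obtain j where "j < n" "canonical_form n P ! j = m"
    by (auto simp: in_set_conv_nth)
  then show "m \<in> {1..length (block_list P)}"
    using canonical_form_nth_mem(1)[OF P, of "Suc j"] by simp
next
  fix m assume m: "m \<in> {1..length (block_list P)}"
  then obtain i where "i \<in> {1..n}" "canonical_form n P ! (i - 1) = m"
    using block_list_nth[OF P m] by blast
  then show "m \<in> set (canonical_form n P)"
    by (auto simp: in_set_conv_nth intro!: exI[of _ "i - 1"])
qed

lemma blocks_of_canonical_form:
  assumes P: "partition_on {1..n} P"
  shows "blocks_of n (canonical_form n P) = P"
proof -
  have "blocks_of n (canonical_form n P) = (\<lambda>m. block_list P ! (m - 1)) ` {1..length (block_list P)}"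
    unfolding blocks_of_def set_canonical_form[OF P]
    by (intro image_cong refl block_list_nth(1)[OF P, symmetric])
  also have "\<dots> = (\<lambda>j. block_list P ! j) ` (\<lambda>m. m - 1) ` {1..length (block_list P)}"
    by (simp add: image_image)
  also have "(\<lambda>m. m - 1) ` {1..length (block_list P)} = {0..<length (block_list P)}"
    by (force simp: image_iff)
  also have "(\<lambda>j. block_list P ! j) ` {0..<length (block_list P)} = set (block_list P)"
    by (auto simp: in_set_conv_nth)
  finally show ?thesis
    using block_list_properties(1)[OF P] by simp
qed

text \<open>Blocks are listed by increasing minima, so the minimum of block \<open>a\<close>
  precedes that of a later block \<open>m\<close>, which is at most any position carrying the letter
  \<open>m\<close>.\<close>

lemma rgf_canonical_form:
  assumes P: "partition_on {1..n} P"
  shows "rgf (canonical_form n P)"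
  unfolding rgf_def
proof (intro allI impI conjI subsetI)
  fix j assume "j < length (canonical_form n P)"
  then have j: "j < n" by simp
  define m where "m = canonical_form n P ! j"
  have m: "m \<in> {1..length (block_list P)}" and jm: "Suc j \<in> block_list P ! (m - 1)"
    using canonical_form_nth_mem[OF P, of "Suc j"] j by (simp_all add: m_def)
  then show "0 < canonical_form n P ! j" by (simp add: m_def)
  fix a assume "a \<in> {1..<canonical_form n P ! j}"
  then have a: "1 \<le> a" "a < m" and al: "a \<in> {1..length (block_list P)}"
    using m by (auto simp: m_def)
  define i where "i = Min (block_list P ! (a - 1))"
  have fin: "finite (block_list P ! (a - 1))" "finite (block_list P ! (m - 1))"
    using block_list_nth(1)[OF P al] block_list_nth(1)[OF P m] by simp_all
  have "i \<in> block_list P ! (a - 1)"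
    unfolding i_def using fin block_list_nth(2)[OF P al] by (intro Min_in)
  then have i: "i \<in> {1..n}" "canonical_form n P ! (i - 1) = a"
    using block_list_nth(1)[OF P al] by auto
  have "i < Min (block_list P ! (m - 1))"
    using sorted_wrt_nth_less[OF block_list_properties(3)[OF P], of "a - 1" "m - 1"] a m
    by (simp add: i_def)
  also have "\<dots> \<le> Suc j"
    using fin jm by simp
  finally have "i - 1 < j" using i by (cases i) auto
  then show "a \<in> set (take j (canonical_form n P))"
    using i(2) j by (auto simp: in_set_conv_nth intro!: exI[of _ "i - 1"])
qed

lemma partition_on_blocks_of:
  assumes "length w = n"
  shows "partition_on {1..n} (blocks_of n w)"
proof (rule partition_onI)
  show "\<Union> (blocks_of n w) = {1..n}"
    using assms by (auto simp: blocks_of_def)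
  show "disjnt p q" if "p \<in> blocks_of n w" "q \<in> blocks_of n w" "p \<noteq> q" for p q
    using that by (auto simp: blocks_of_def disjnt_def)
  show "{} \<notin> blocks_of n w"
  proof
    assume "{} \<in> blocks_of n w"
    then obtain m where m: "m \<in> set w" "{i \<in> {1..n}. w ! (i - 1) = m} = {}"
      by (auto simp: blocks_of_def)
    then obtain j where "j < n" "w ! j = m"
      using assms by (auto simp: in_set_conv_nth)
    then have "Suc j \<in> {i \<in> {1..n}. w ! (i - 1) = m}" by simp
    then show False using m by blast
  qed
qed

text \<open>By the growth condition the level sets of \<open>w\<close>, listed by letter, have
  increasing minima. A strictly increasing list is determined by its set, so this list must be the
  block list.\<close>

lemma canonical_form_blocks_of:
  assumes w: "rgf w" "length w = n"
  shows "canonical_form n (blocks_of n w) = w"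
proof -
  define P where "P = blocks_of n w"
  define B where "B m = {i \<in> {1..n}. w ! (i - 1) = m}" for m
  obtain M where M: "set w = {1..M}"
    using w by (metis rgf_setE)
  define l where "l = map B [1..<Suc M]"
  have P: "partition_on {1..n} P"
    unfolding P_def using w(2) by (rule partition_on_blocks_of)
  have "set [1..<Suc M] = {1..M}" by auto
  then have setl: "set l = P"
    unfolding l_def set_map P_def blocks_of_def M B_def by simp
  have ne: "B m \<noteq> {}" if "m \<in> {1..M}" for m
  proof -
    have "B m \<in> P" using that by (auto simp: P_def blocks_of_def B_def M)
    then show ?thesis using partition_onD3[OF P] by metis
  qed
  \<comment> \<open>Growth at the position \<open>Min (B b)\<close>, which carries the letter
    \<open>b\<close>, forces an earlier \<open>a\<close>.\<close>
  have Min_less: "Min (B a) < Min (B b)" if "a \<in> {1..M}" "b \<in> {1..M}" "a < b" for a b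
  proof -
    have "Min (B b) \<in> B b"
      using ne[OF that(2)] by (intro Min_in) (simp add: B_def)
    then have i: "Min (B b) \<in> {1..n}" "w ! (Min (B b) - 1) = b"
      by (auto simp: B_def)
    have "a \<in> set (take (Min (B b) - 1) w)"
      using w i that unfolding rgf_def by (auto dest!: spec[of _ "Min (B b) - 1"])
    then obtain j where j: "j < Min (B b) - 1" "j < n" "w ! j = a"
      using w(2) by (auto simp: in_set_conv_nth)
    then have "Suc j \<in> B a" by (simp add: B_def)
    then have "Min (B a) \<le> Suc j" by (intro Min_le) (auto simp: B_def)
    then show ?thesis using j by linarith
  qed
  have "sorted_wrt (<) (map Min l)"
    unfolding sorted_wrt_iff_nth_less l_def using Min_less by (auto simp del: upt_Suc)
  moreover have sorted: "sorted_wrt (<) (map Min (block_list P))"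
    using block_list_properties(3)[OF P] .
  moreover have "set (map Min l) = set (map Min (block_list P))"
    using setl block_list_properties(1)[OF P] by simp
  ultimately have "map Min (block_list P) = map Min l"
    by (metis strict_sorted_equal)
  moreover have "distinct (map Min (block_list P))"
    using sorted strict_sorted_iff by blast
  \<comment> \<open>Injectivity lifts the equality of the lists of minima to the lists of
    blocks.\<close>
  then have "inj_on Min P"
    using block_list_properties(1)[OF P] by (simp add: distinct_map)
  ultimately have bl: "block_list P = l"
    using setl block_list_properties(1)[OF P] by (intro map_inj_on[of Min]) auto
  show ?thesis
    unfolding P_def[symmetric]
  proof (rule nth_equalityI)
    show "length (canonical_form n P) = length w" using w by simp
    fix j assume "j < length (canonical_form n P)"
    then have j: "j < n" by simp
    then have m: "w ! j \<in> {1..M}" using nth_mem[of j w] M w(2) by simp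
    then obtain m' where "w ! j = Suc m'" "m' < M"
      by (cases "w ! j") auto
    then have "l ! (w ! j - 1) = B (w ! j)"
      by (simp add: l_def del: upt_Suc)
    moreover have "Suc j \<in> B (w ! j)"
      using j by (simp add: B_def)
    ultimately have "Suc j \<in> block_list P ! (w ! j - 1)"
      by (simp add: bl)
    moreover have "length (block_list P) = M"
      by (simp add: bl l_def)
    ultimately show "canonical_form n P ! j = w ! j"
      using canonical_form_unique[OF P, of "Suc j" "w ! j"] j m by simp
  qed
qed

section \<open>Counting by the number of unblocked letters\<close>

definition admissible :: "nat \<Rightarrow> nat list \<Rightarrow> bool" where
  "admissible k w \<longleftrightarrow> rgf w \<and> nonblocking k w"

lemma admissible_snoc:
  "admissible k (w @ [a]) \<longleftrightarrow> admissible k w \<and> 0 < a \<and> {1..<a} \<subseteq> set w \<and> \<not> blocked k w a"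
  by (auto simp: admissible_def rgf_snoc nonblocking_snoc)

lemma admissible_append: "admissible k (u @ v) \<Longrightarrow> admissible k u"
  by (induction v rule: rev_induct) (auto simp: admissible_snoc simp flip: append_assoc)

text \<open>The bijection is \<open>canonical_form\<close>, with inverse
  \<open>blocks_of\<close>.\<close>

lemma card_noncrossing_partitions:
  assumes "k \<ge> 2"
  shows "card (noncrossing_partitions k n) = card {w. length w = n \<and> admissible k w}"
proof -
  have "inj_on (canonical_form n) (noncrossing_partitions k n)"
    by (rule inj_on_inverseI[of _ "blocks_of n"])
      (simp add: noncrossing_partitions_def blocks_of_canonical_form)
  moreover have "canonical_form n ` noncrossing_partitions k n = {w. length w = n \<and> admissible k w}"
  proof (intro equalityI subsetI)
    fix w assume "w \<in> canonical_form n ` noncrossing_partitions k n"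
    then show "w \<in> {w. length w = n \<and> admissible k w}"
      using assms by (auto simp: noncrossing_partitions_def noncrossing_def admissible_def
          rgf_canonical_form avoids_iff_nonblocking)
  next
    fix w assume "w \<in> {w. length w = n \<and> admissible k w}"
    then have w: "length w = n" "rgf w" "nonblocking k w"
      by (auto simp: admissible_def)
    then have "blocks_of n w \<in> noncrossing_partitions k n"
      using assms by (simp add: noncrossing_partitions_def noncrossing_def partition_on_blocks_of
          canonical_form_blocks_of avoids_iff_nonblocking del: One_nat_def)
    then show "w \<in> canonical_form n ` noncrossing_partitions k n"
      using canonical_form_blocks_of[OF w(2,1)] by (metis imageI)
  qed
  ultimately show ?thesis
    by (metis card_image)
qed

section \<open>The walk on the number of unblocked letters\<close>

definition unblocked :: "nat \<Rightarrow> nat list \<Rightarrow> nat set" where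
  "unblocked k w = {b \<in> set w. \<not> blocked k w b}"

text \<open>The state \<open>r\<close> is the number of unblocked letters among those that have occurred.\<close>

fun walks :: "nat \<Rightarrow> nat \<Rightarrow> nat \<Rightarrow> nat" where
  "walks k 0 r = 1"
| "walks k (Suc n) r = walks k n (Suc r) + min r (k - 2) * walks k n r
     + (\<Sum>j = 1..r - (k - 2). walks k n (k - 2 + j))"

text \<open>Inserting a new maximum leaves the other ranks unchanged and adds the next rank. This
  turns a sum over letters into a sum over states.\<close>

lemma sum_rank:
  fixes S :: "nat set"
  assumes "finite S"
  shows "(\<Sum>a\<in>S. g (card {b \<in> S. b \<le> a})) = (\<Sum>j = 1..card S. g j)"
  using assms
proof (induction rule: finite_linorder_max_induct)
  case empty
  then show ?case by simp
next
  case (insert b A)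
  have "b \<notin> A" using insert.hyps(2) by blast
  have "{c \<in> insert b A. c \<le> b} = insert b A"
    using insert.hyps(2) by auto
  moreover have "{c \<in> insert b A. c \<le> a} = {c \<in> A. c \<le> a}" if "a \<in> A" for a
    using insert.hyps(2) that by auto
  ultimately show ?case
    using insert.IH insert.hyps(1) \<open>b \<notin> A\<close> by (simp add: add.commute cong: sum.cong)
qed

text \<open>The new letter is the maximum, so it blocks no letter present; it is itself unblocked
  because \<open>Suc M + k - 2\<close> exceeds \<open>M\<close>.\<close>

lemma unblocked_snoc_new:
  assumes "k \<ge> 2" "set w = {1..M}"
  shows "unblocked k (w @ [Suc M]) = insert (Suc M) (unblocked k w)"
proof -
  have "\<not> blocked k w (Suc M)"
    using blocked_mem[of k w "Suc M"] assms by auto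
  then show ?thesis
    using assms by (auto simp: unblocked_def blocked_snoc)
qed

text \<open>An unblocked letter \<open>b\<close> above \<open>a\<close> becomes blocked exactly when
  \<open>b + k - 2\<close> has occurred, so the largest \<open>k - 2\<close> letters
  survive.\<close>

lemma unblocked_snoc_old:
  assumes "k \<ge> 2" "set w = {1..M}" "a \<in> unblocked k w"
  shows "unblocked k (w @ [a]) = {b \<in> unblocked k w. b \<le> a \<or> M < b + (k - 2)}"
  using assms by (auto simp: unblocked_def blocked_snoc)

text \<open>Classifying the first letter of \<open>u\<close> yields the recurrence of
  \<open>walks\<close>. A new letter raises the state by one, one of the largest
  \<open>k - 2\<close> letters keeps it, and the letter of rank \<open>j\<close> among the other
  unblocked ones leads to \<open>k - 2 + j\<close>. Finiteness is carried along to count the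
  disjoint union.\<close>

lemma card_extensions:
  assumes "k \<ge> 2" "admissible k w"
  shows "finite {u. length u = n \<and> admissible k (w @ u)} \<and>
    card {u. length u = n \<and> admissible k (w @ u)} = walks k n (card (unblocked k w))"
  using assms(2)
proof (induction n arbitrary: w)
  case 0
  then have "{u. length u = 0 \<and> admissible k (w @ u)} = {[]}" by auto
  then show ?case by simp
next
  case (Suc n)
  obtain M where M: "set w = {1..M}"
    using Suc.prems by (metis admissible_def rgf_setE)
  define S where "S = unblocked k w"
  \<comment> \<open>\<open>T\<close> holds the largest \<open>k - 2\<close> letters so far (all of
    them if there are fewer); \<open>L\<close> holds the other unblocked letters, all smaller than
    those of \<open>T\<close>.\<close>
  define T where "T = {b \<in> {1..M}. M < b + (k - 2)}"
  define L where "L = S - T"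
  define E where "E v = {u. length u = n \<and> admissible k (v @ u)}" for v
  have fin: "finite S" "finite T" "finite L"
    by (simp_all add: S_def T_def L_def unblocked_def)
  have "\<not> blocked k w b" if "b \<in> T" for b
    using that blocked_mem[of k w b] assms(1) by (auto simp: T_def M)
  then have S: "S = T \<union> L" "T \<inter> L = {}"
    by (auto simp: S_def T_def L_def unblocked_def M)
  have newS: "Suc M \<notin> S"
    by (auto simp: S_def unblocked_def M)
  have adm: "admissible k (w @ [a]) \<longleftrightarrow> a \<in> insert (Suc M) S" for a
  proof -
    have "0 < a \<and> {1..<a} \<subseteq> set w \<longleftrightarrow> a \<in> insert (Suc M) (set w)"
      using atLeastLessThan_subset_iff[of 1 a 1 "Suc M"]
      by (auto simp: M atLeastLessThanSuc_atLeastAtMost)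
    moreover have "\<not> blocked k w (Suc M)"
      using blocked_mem[of k w "Suc M"] assms(1) M by auto
    ultimately show ?thesis
      using Suc.prems by (auto simp: admissible_snoc S_def unblocked_def)
  qed
  have split: "{u. length u = Suc n \<and> admissible k (w @ u)} =
      (\<Union>a\<in>insert (Suc M) S. Cons a ` E (w @ [a]))"
  proof (intro equalityI subsetI)
    fix u assume "u \<in> {u. length u = Suc n \<and> admissible k (w @ u)}"
    then obtain a v where u: "u = a # v" "length v = n" "admissible k ((w @ [a]) @ v)"
      by (auto simp: length_Suc_conv)
    then have "a \<in> insert (Suc M) S"
      using adm admissible_append by blast
    then show "u \<in> (\<Union>a\<in>insert (Suc M) S. Cons a ` E (w @ [a]))"
      using u by (auto simp: E_def)
  qed (auto simp: E_def)
  have IH: "finite (E (w @ [a]))" "card (E (w @ [a])) = walks k n (card (unblocked k (w @ [a])))"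
    if "a \<in> insert (Suc M) S" for a
    using Suc.IH[of "w @ [a]"] adm[of a] that unfolding E_def by blast+
  have cardT: "card T = min M (k - 2)"
  proof -
    have "T = {Suc (M - (k - 2))..M}" by (auto simp: T_def)
    then show ?thesis by simp
  qed
  have cardS: "card S = card T + card L"
    using S fin by (simp add: card_Un_disjoint)
  \<comment> \<open>A member of \<open>L\<close> is a positive letter at most
    \<open>M - (k - 2)\<close>, so \<open>M\<close> exceeds \<open>k - 2\<close>.\<close>
  have cardT_L: "card T = k - 2" if L: "L \<noteq> {}"
  proof -
    obtain b where "b \<in> L" using L by blast
    then have "b \<in> {1..M}" "b \<notin> T" by (auto simp: L_def S_def unblocked_def M)
    then show ?thesis unfolding cardT by (auto simp: T_def)
  qed
  have T_min: "card T = min (card S) (k - 2)"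
    using cardT cardS cardT_L by (cases "L = {}") auto
  have old: "unblocked k (w @ [a]) = T \<union> {b \<in> L. b \<le> a}" if "a \<in> S" for a
  proof -
    have "S \<subseteq> {1..M}" by (auto simp: S_def unblocked_def M)
    then have "{b \<in> S. b \<le> a \<or> M < b + (k - 2)} = T \<union> {b \<in> L. b \<le> a}"
      using \<open>\<And>b. b \<in> T \<Longrightarrow> \<not> blocked k w b\<close> by (auto simp: T_def L_def S_def unblocked_def M)
    then show ?thesis
      using unblocked_snoc_old[OF assms(1) M, of a] that by (simp add: S_def)
  qed
  \<comment> \<open>Letters of \<open>L\<close> lie below \<open>a\<close> and letters of
    \<open>T\<close> cannot be blocked, so the state is unchanged.\<close>
  have oldT: "unblocked k (w @ [a]) = S" if "a \<in> T" for a
  proof -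
    have "b \<le> a" if "b \<in> L" for b
    proof -
      have "b \<in> {1..M}" "b \<notin> T" using that by (auto simp: L_def S_def unblocked_def M)
      then show ?thesis using \<open>a \<in> T\<close> by (auto simp: T_def)
    qed
    then show ?thesis using old[of a] that S by auto
  qed
  have oldL: "card (unblocked k (w @ [a])) = card T + card {b \<in> L. b \<le> a}" if "a \<in> L" for a
    using old[of a] that S fin by (subst card_Un_disjoint[symmetric]) auto
  have "card (\<Union>a\<in>insert (Suc M) S. Cons a ` E (w @ [a])) =
      (\<Sum>a\<in>insert (Suc M) S. card (Cons a ` E (w @ [a])))"
    using fin IH(1) by (intro card_UN_disjoint) auto
  also have "\<dots> = (\<Sum>a\<in>insert (Suc M) S. walks k n (card (unblocked k (w @ [a]))))"
    using IH(2) by (intro sum.cong refl) (simp add: card_image)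
  also have "\<dots> = walks k n (Suc (card S)) + (\<Sum>a\<in>S. walks k n (card (unblocked k (w @ [a]))))"
    using fin newS unblocked_snoc_new[OF assms(1) M] by (simp add: S_def[symmetric])
  also have "(\<Sum>a\<in>S. walks k n (card (unblocked k (w @ [a])))) =
      (\<Sum>a\<in>T. walks k n (card (unblocked k (w @ [a])))) +
      (\<Sum>a\<in>L. walks k n (card (unblocked k (w @ [a]))))"
    unfolding S(1) using fin S(2) by (intro sum.union_disjoint)
  also have "(\<Sum>a\<in>T. walks k n (card (unblocked k (w @ [a])))) = min (card S) (k - 2) * walks k n (card S)"
    using oldT T_min by simp
  also have "(\<Sum>a\<in>L. walks k n (card (unblocked k (w @ [a])))) =
      (\<Sum>a\<in>L. walks k n (card T + card {b \<in> L. b \<le> a}))"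
    using oldL by simp
  also have "\<dots> = (\<Sum>j = 1..card L. walks k n (card T + j))"
    using sum_rank[OF fin(3), of "\<lambda>i. walks k n (card T + i)"] .
  \<comment> \<open>If \<open>L\<close> is empty, then \<open>card S\<close> is at most
    \<open>k - 2\<close> and both sums are empty.\<close>
  also have "\<dots> = (\<Sum>j = 1..card S - (k - 2). walks k n (k - 2 + j))"
    using cardT cardS cardT_L by (cases "L = {}") auto
  finally have "card (\<Union>a\<in>insert (Suc M) S. Cons a ` E (w @ [a])) = walks k (Suc n) (card S)"
    by simp
  then show ?case
    unfolding split using fin IH(1) by (auto simp: S_def)
qed

lemma card_noncrossing_partitions_walks:
  assumes "k \<ge> 2"
  shows "card (noncrossing_partitions k n) = walks k n 0"
proof -
  have "admissible k []" by (simp add: admissible_def)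
  moreover have "unblocked k [] = {}" by (simp add: unblocked_def)
  ultimately show ?thesis
    using card_extensions[OF assms, of "[]" n] card_noncrossing_partitions[OF assms] by simp
qed

section \<open>Generating functions\<close>

text \<open>With the radicand written as \<open>(A - 2 x)^2 - 4 x^2\<close>, squaring
  \<open>A - 2 x A y\<close> leaves \<open>4 x A\<close> times the desired equation; this nonzero
  factor cancels.\<close>

lemma y_series_equation:
  fixes k :: nat
  assumes "k \<ge> 2"
  defines "A \<equiv> 1 - of_nat (k - 2) * fps_X :: real fps"
  shows "A * y_series k * (1 - fps_X * y_series k) = 1"
proof -
  let ?y = "y_series k" and ?x = "fps_X :: real fps"
  have k: "of_nat k = of_nat (k - 2) + (2 :: real fps)"
    using assms(1) by (simp add: of_nat_diff)
  have "sqrt_series k = A - ?y * (2 * ?x * A)"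
    using y_series_mult[of k] by (simp add: A_def)
  then have "(A - ?y * (2 * ?x * A))\<^sup>2 = (1 - of_nat k * ?x)\<^sup>2 - 4 * ?x\<^sup>2"
    using fps_sqrt_series(2)[of k] by simp
  also have "1 - of_nat k * ?x = A - 2 * ?x"
    by (simp add: A_def k algebra_simps)
  finally have "4 * ?x * A * (A * ?y * (1 - ?x * ?y) - 1) = 0"
    by algebra
  moreover have "A \<noteq> 0"
  proof
    assume "A = 0"
    then have "fps_nth A 0 = 0" by simp
    then show False by (simp add: A_def)
  qed
  ultimately show ?thesis by simp
qed

lemma y_series_nth_0:
  assumes "k \<ge> 2"
  shows "fps_nth (y_series k) 0 = 1"
  using arg_cong[OF y_series_equation[OF assms], of "\<lambda>f. fps_nth f 0"] by simp

lemma of_nat_fps_nth: "fps_nth (of_nat c * f) n = of_nat c * fps_nth f n" for f :: "real fps"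
  by (simp flip: fps_of_nat)

text \<open>The series \<open>y (A y)^m\<close> satisfy the recurrence of the walks: moving the
  \<open>k - 2\<close> loops to the left gives the factor \<open>A\<close>, and the equation of
  \<open>y\<close> reads \<open>A y - 1 = x y (A y)\<close>.\<close>

lemma walks_high:
  assumes "k \<ge> 2"
  shows "real (walks k n (k - 2 + m)) =
    fps_nth (y_series k * ((1 - of_nat (k - 2) * fps_X) * y_series k) ^ m) n"
proof -
  let ?y = "y_series k" and ?x = "fps_X :: real fps"
  define A where "A = 1 - of_nat (k - 2) * ?x"
  define T where "T m = ?y * (A * ?y) ^ m" for m
  have eq: "A * ?y * (1 - ?x * ?y) = 1"
    using y_series_equation[OF assms] by (simp add: A_def)
  have T_rec: "T m = 1 + ?x * (T (Suc m) + of_nat (k - 2) * T m + (\<Sum>j = 1..m. T j))" for m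
  proof -
    have "A * T m = 1 + ?x * (T (Suc m) + (\<Sum>j = 1..m. T j))"
    proof (induction m)
      case 0
      have "A * ?y = 1 + ?x * (?y * (A * ?y))"
        using eq by algebra
      then show ?case by (simp add: T_def)
    next
      case (Suc m)
      \<comment> \<open>Here \<open>p\<close> stands for \<open>(A y)^m\<close>. In the difference
        of consecutive instances the sums collapse to \<open>x\<close> times
        \<open>T (Suc (Suc m))\<close>.\<close>
      have "A * (?y * (A * ?y * p) - ?y * p) = ?x * (?y * (A * ?y * (A * ?y * p)))" for p
        using eq by algebra
      then have "A * (T (Suc m) - T m) = ?x * T (Suc (Suc m))"
        by (simp add: T_def)
      then show ?case
        using Suc by (simp add: algebra_simps)
    qed
    then show ?thesis by (simp add: A_def algebra_simps)
  qed
  have "real (walks k n (k - 2 + m)) = fps_nth (T m) n"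
  proof (induction n arbitrary: m)
    case 0
    then show ?case
      using assms by (simp add: T_def A_def y_series_nth_0 fps_nth_power_0)
  next
    case (Suc n)
    have "real (walks k (Suc n) (k - 2 + m)) =
        real (walks k n (k - 2 + Suc m)) + of_nat (k - 2) * real (walks k n (k - 2 + m))
          + (\<Sum>j = 1..m. real (walks k n (k - 2 + j)))"
      by simp
    also have "\<dots> = fps_nth (T (Suc m) + of_nat (k - 2) * T m + (\<Sum>j = 1..m. T j)) n"
      unfolding Suc.IH by (simp add: of_nat_fps_nth fps_sum_nth)
    also have "\<dots> = fps_nth (T m) (Suc n)"
      by (subst (4) T_rec) simp
    finally show ?case .
  qed
  then show ?thesis by (simp add: T_def A_def)
qed

section \<open>Elimination of the states up to \<open>k - 2\<close>\<close>

definition walk_series :: "nat \<Rightarrow> nat \<Rightarrow> real fps" where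
  "walk_series k r = Abs_fps (\<lambda>n. real (walks k n r))"

text \<open>For \<open>r\<close> at most \<open>k - 2\<close> the minimum in \<open>walks\<close> is
  \<open>r\<close> and the last sum is empty, so only the states \<open>r\<close> and
  \<open>Suc r\<close> are linked.\<close>

lemma walk_series_low:
  assumes "r \<le> k - 2"
  shows "(1 - of_nat r * fps_X) * walk_series k r = 1 + fps_X * walk_series k (Suc r)"
proof -
  have "walk_series k r = 1 + fps_X * (walk_series k (Suc r) + of_nat r * walk_series k r)"
  proof (rule fps_ext)
    fix n
    show "fps_nth (walk_series k r) n =
      fps_nth (1 + fps_X * (walk_series k (Suc r) + of_nat r * walk_series k r)) n"
      using assms by (cases n) (simp_all add: walk_series_def of_nat_fps_nth)
  qed
  then show ?thesis by (simp add: algebra_simps)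
qed

lemma prod_greaterThanAtMost_Suc:
  fixes f :: "nat \<Rightarrow> 'a :: comm_monoid_mult"
  assumes "i \<le> K"
  shows "prod f {i<..Suc K} = f (Suc K) * prod f {i<..K}"
proof -
  have "{i<..Suc K} = insert (Suc K) {i<..K}" using assms by auto
  then show ?thesis by simp
qed

text \<open>Multiplying by the next factor \<open>1 - (K + 1) x\<close> lets
  \<open>walk_series_low\<close> push the remainder one state further, leaving behind the new term
  \<open>x^(K + 1)\<close>.\<close>

lemma walk_series_0:
  assumes "K \<le> k - 2"
  shows "(\<Prod>s\<in>{0<..K}. 1 - of_nat s * fps_X) * walk_series k 0 =
    (\<Sum>i = 0..K. fps_X ^ i * (\<Prod>s\<in>{i<..K}. 1 - of_nat s * fps_X)) + fps_X ^ Suc K * walk_series k (Suc K)"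
  using assms
proof (induction K)
  case 0
  then show ?case using walk_series_low[of 0 k] by simp
next
  case (Suc K)
  let ?c = "1 - of_nat (Suc K) * fps_X :: real fps"
  have "(\<Prod>s\<in>{0<..Suc K}. 1 - of_nat s * fps_X) * walk_series k 0 =
      ?c * ((\<Prod>s\<in>{0<..K}. 1 - of_nat s * fps_X) * walk_series k 0)"
    by (simp add: prod_greaterThanAtMost_Suc mult.assoc del: of_nat_Suc)
  also have "\<dots> = (\<Sum>i = 0..K. fps_X ^ i * (?c * (\<Prod>s\<in>{i<..K}. 1 - of_nat s * fps_X))) +
      fps_X ^ Suc K * (?c * walk_series k (Suc K))"
    using Suc by (simp add: distrib_left sum_distrib_left mult.left_commute del: of_nat_Suc)
  also have "?c * walk_series k (Suc K) = 1 + fps_X * walk_series k (Suc (Suc K))"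
    using walk_series_low Suc.prems by blast
  finally show ?case
    by (simp add: prod_greaterThanAtMost_Suc distrib_left mult.assoc mult.left_commute del: of_nat_Suc)
qed

text \<open>Summed over \<open>j\<close>, the weights \<open>(-1) ^ (i + j) * beta_series i j\<close> telescope to a product.\<close>

lemma sum_beta_series:
  "(\<Sum>j = 0..K. \<Sum>i = 0..j. (-1) ^ (i + j) * c i * beta_series i j) =
    (\<Sum>i = 0..K. c i * (\<Prod>s\<in>{i<..K}. 1 - of_nat s * fps_X))"
proof (induction K)
  case 0
  then show ?case by (simp add: beta_series_def)
next
  case (Suc K)
  let ?p = "\<lambda>i K. \<Prod>s\<in>{i<..K}. 1 - of_nat s * fps_X :: real fps"
  have sign: "(-1) ^ (i + Suc K) * beta_series i (Suc K) = - (of_nat (Suc K) * fps_X * ?p i K)"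
    if "i \<le> K" for i
  proof -
    have "(\<Prod>s\<in>{i<..K}. of_nat s * fps_X - 1) = (-1) ^ (K - i) * ?p i K"
      using prod.distrib[of "\<lambda>_. -1" "\<lambda>s. 1 - of_nat s * fps_X :: real fps" "{i<..K}"] by simp
    moreover have "{i<..<Suc K} = {i<..K}" by auto
    ultimately have beta: "beta_series i (Suc K) = of_nat (Suc K) * fps_X * ((-1) ^ (K - i) * ?p i K)"
      using that by (simp add: beta_series_def)
    \<comment> \<open>The sign exponents add up to an odd number.\<close>
    have "i + Suc K + (K - i) = Suc (2 * K)" using that by simp
    then have "(-1) ^ (i + Suc K) * (-1) ^ (K - i) = (-1 :: real fps) ^ Suc (2 * K)"
      by (metis power_add)
    then have sign: "(-1) ^ (i + Suc K) * (-1) ^ (K - i) = (-1 :: real fps)"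
      by simp
    have "(-1) ^ (i + Suc K) * beta_series i (Suc K) =
        ((-1) ^ (i + Suc K) * (-1) ^ (K - i)) * (of_nat (Suc K) * fps_X * ?p i K)"
      unfolding beta by (simp only: mult_ac)
    then show ?thesis
      unfolding sign by simp
  qed
  have "(\<Sum>i = 0..Suc K. (-1) ^ (i + Suc K) * c i * beta_series i (Suc K)) =
      c (Suc K) + (\<Sum>i = 0..K. c i * ((-1) ^ (i + Suc K) * beta_series i (Suc K)))"
    by (simp add: beta_series_def mult_ac flip: mult_2)
  also have "(\<Sum>i = 0..K. c i * ((-1) ^ (i + Suc K) * beta_series i (Suc K))) =
      (\<Sum>i = 0..K. c i * - (of_nat (Suc K) * fps_X * ?p i K))"
    using sign by (intro sum.cong refl) simp
  also have "\<dots> = - (of_nat (Suc K) * fps_X) * (\<Sum>i = 0..K. c i * ?p i K)"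
    by (simp add: sum_distrib_left sum_negf mult_ac del: of_nat_Suc)
  finally have last: "(\<Sum>i = 0..Suc K. (-1) ^ (i + Suc K) * c i * beta_series i (Suc K)) =
      c (Suc K) + - (of_nat (Suc K) * fps_X) * (\<Sum>i = 0..K. c i * ?p i K)" .
  \<comment> \<open>Adding \<open>last\<close> to the sum up to \<open>K\<close> multiplies that sum
    by \<open>1 - (K + 1) x\<close> and adds \<open>c (Suc K)\<close>, just as extending the
    products does.\<close>
  have "(\<Sum>i = 0..Suc K. c i * ?p i (Suc K)) =
      (1 - of_nat (Suc K) * fps_X) * (\<Sum>i = 0..K. c i * ?p i K) + c (Suc K)"
    by (simp add: prod_greaterThanAtMost_Suc sum_distrib_left mult.left_commute del: of_nat_Suc)
  then show ?case
    unfolding sum.atLeast0_atMost_Suc[of _ K, where g = "\<lambda>j. \<Sum>i = 0..j. (-1) ^ (i + j) * c i * beta_series i j"]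
      last Suc.IH
    by (simp add: algebra_simps del: of_nat_Suc sum.atLeast0_atMost_Suc)
qed

text \<open>Since \<open>i x = 1 - (1 - i x)\<close>, each term is a difference of consecutive tail
  products and the sum telescopes. This identifies the denominator with the factor in
  \<open>walk_series_0\<close>.\<close>

lemma sum_weighted_products:
  "1 - (\<Sum>i = 0..K. of_nat i * fps_X * (\<Prod>s\<in>{i<..K}. 1 - of_nat s * fps_X)) =
    (\<Prod>s\<in>{0<..K}. 1 - of_nat s * fps_X :: real fps)"
proof (induction K)
  case 0
  then show ?case by simp
next
  case (Suc K)
  let ?c = "1 - of_nat (Suc K) * fps_X :: real fps"
  have "(\<Sum>i = 0..Suc K. of_nat i * fps_X * (\<Prod>s\<in>{i<..Suc K}. 1 - of_nat s * fps_X)) =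
      ?c * (\<Sum>i = 0..K. of_nat i * fps_X * (\<Prod>s\<in>{i<..K}. 1 - of_nat s * fps_X)) + of_nat (Suc K) * fps_X"
    by (simp add: prod_greaterThanAtMost_Suc sum_distrib_left mult.left_commute del: of_nat_Suc)
  then have "1 - (\<Sum>i = 0..Suc K. of_nat i * fps_X * (\<Prod>s\<in>{i<..Suc K}. 1 - of_nat s * fps_X)) =
      ?c * (1 - (\<Sum>i = 0..K. of_nat i * fps_X * (\<Prod>s\<in>{i<..K}. 1 - of_nat s * fps_X)))"
    by (simp add: algebra_simps del: of_nat_Suc sum.atLeast0_atMost_Suc)
  then show ?case
    using Suc by (simp add: prod_greaterThanAtMost_Suc del: of_nat_Suc sum.atLeast0_atMost_Suc)
qed

section \<open>Assembling the generating function\<close>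

theorem theorem1:
  fixes k :: nat
  assumes "k \<ge> 2"
  shows "Abs_fps (\<lambda>n. real (card (noncrossing_partitions k n))) =
    (fps_X ^ (k - 1) * y_series k / (1 - fps_X * y_series k)
       + (\<Sum>j = 0..k - 2. \<Sum>i = 0..j. (-1) ^ (i + j) * fps_X ^ i * beta_series i j))
    / (1 - (\<Sum>j = 0..k - 2. \<Sum>i = 0..j. (-1) ^ (i + j) * of_nat i * fps_X * beta_series i j))"
proof -
  let ?y = "y_series k" and ?x = "fps_X :: real fps"
  let ?p = "\<lambda>i. \<Prod>s\<in>{i<..k - 2}. 1 - of_nat s * fps_X :: real fps"
  define A where "A = 1 - of_nat (k - 2) * ?x"
  have eq: "A * ?y * (1 - ?x * ?y) = 1"
    using y_series_equation[OF assms] by (simp add: A_def)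
  have "1 - ?x * ?y \<noteq> 0"
    using eq by auto
  \<comment> \<open>Since \<open>A y\<close> is inverse to \<open>1 - x y\<close>, the quotient of
    \<open>y\<close> by \<open>1 - x y\<close> is \<open>A y^2\<close> and the division is
    exact.\<close>
  have "p * ?y = p * (?y * (A * ?y)) * (1 - ?x * ?y)" for p
    using eq by algebra
  then have "?x ^ (k - 1) * ?y / (1 - ?x * ?y) =
      ?x ^ (k - 1) * (?y * (A * ?y)) * (1 - ?x * ?y) / (1 - ?x * ?y)"
    by (rule arg_cong)
  also have "\<dots> = ?x ^ (k - 1) * (?y * (A * ?y))"
    using \<open>1 - ?x * ?y \<noteq> 0\<close> by (rule nonzero_mult_div_cancel_right)
  finally have high: "?x ^ (k - 1) * ?y / (1 - ?x * ?y) = ?x ^ (k - 1) * (?y * (A * ?y))" .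
  have num: "(\<Sum>j = 0..k - 2. \<Sum>i = 0..j. (-1) ^ (i + j) * ?x ^ i * beta_series i j) =
      (\<Sum>i = 0..k - 2. ?x ^ i * ?p i)"
    by (rule sum_beta_series)
  have den: "1 - (\<Sum>j = 0..k - 2. \<Sum>i = 0..j. (-1) ^ (i + j) * of_nat i * ?x * beta_series i j) = ?p 0"
    using sum_beta_series[of "\<lambda>i. of_nat i * ?x" "k - 2"] sum_weighted_products[of "k - 2"]
    by (simp add: mult.assoc)
  \<comment> \<open>The state left over by the elimination is \<open>k - 2 + m\<close> with
    \<open>m = 1\<close>.\<close>
  have "walk_series k (Suc (k - 2)) = ?y * (A * ?y)"
    using walks_high[OF assms, of _ 1] by (intro fps_ext) (simp add: walk_series_def A_def)
  moreover have "Suc (k - 2) = k - 1" using assms by simp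
  ultimately have total: "?p 0 * walk_series k 0 =
      ?x ^ (k - 1) * (?y * (A * ?y)) + (\<Sum>i = 0..k - 2. ?x ^ i * ?p i)"
    using walk_series_0[of "k - 2" k] by simp
  have nz: "?p 0 \<noteq> 0"
  proof -
    have "1 - of_nat s * ?x \<noteq> 0" for s
    proof
      assume "1 - of_nat s * ?x = 0"
      then have "fps_nth (1 - of_nat s * ?x) 0 = 0" by (simp only: fps_zero_nth)
      then show False by simp
    qed
    then show ?thesis by simp
  qed
  have "Abs_fps (\<lambda>n. real (card (noncrossing_partitions k n))) = walk_series k 0"
    by (simp only: walk_series_def card_noncrossing_partitions_walks[OF assms])
  also have "\<dots> = ?p 0 * walk_series k 0 / ?p 0"
    using nz by (rule nonzero_mult_div_cancel_left[symmetric])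
  finally show ?thesis
    unfolding high num den total .
qed

end
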